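(* Consider the class $\mathcal{F}_{csc}$ of convex-strongly-convex bilevel problems and the hypergradient-based algorithm class (see context), and let $\beta=\frac{\widetilde L_y-\mu_y}{4}$. Suppose $\beta\le\mathcal{O}(1)$, i.e., $\beta$ is at a constant level. Then there exists an instance in $\mathcal{F}_{csc}$ with dimensions $p=q=d$ such that, for any algorithm in the hypergradient-based algorithm class, the complexity of achieving $\|\nabla\Phi(x^K)\|\le\epsilon$ satisfies $$\mathcal{C}_{\mathrm{norm}}(\mathcal{A},\epsilon)\ge\widetilde\Omega\Big(\frac{1}{\sqrt\epsilon}\min\Big\{\frac{1}{\mu_y},\frac{1}{\sqrt{\epsilon^3}}\Big\}\Big).$$
   Context: Bilevel problem: minimize $\Phi(x)=f(x,y^*(x))$, $y^*(x)=\arg\min_{y\in\mathbb{R}^q}g(x,y)$, $x\in\mathbb{R}^p$. Class $\mathcal{F}_{csc}$: (a) there are constants $L_x,L_{xy},L_y,\widetilde L_{xy},\widetilde L_y\ge0$ such that $\nabla_x f$ is $L_x$-Lipschitz in $x$ and $L_{xy}$-Lipschitz in $y$, $\nabla_y f$ is $L_{xy}$-Lipschitz in $x$ and $L_y$-Lipschitz in $y$, $\nabla_y g$ is $\widetilde L_{xy}$-Lipschitz in $x$ and $\widetilde L_y$-Lipschitz in $y$; (b) there are $\rho_{xy},\rho_{yy}\ge0$ such that $\nabla_x\nabla_y g$ is $\rho_{xy}$-Lipschitz and $\nabla_y^2 g$ is $\rho_{yy}$-Lipschitz in $(x,y)$; (c) $\|x^*\|=B$ for some constant $B>0$, where $x^*\in\arg\min\Phi$;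 (d) $\Phi$ is convex and $g(x,\cdot)$ is $\mu_y$-strongly convex for every $x$. Hypergradient-based algorithm class: there are $K$ iterations in total, and $x$ is updated $Q$ times, at iterations $s_0<\dots<s_{Q-1}\le K$, where $Q$ and the $s_i$ are arbitrary; $T\in\mathbb{N}$ bounds the number of Hessian-vector products per $x$-update. Iterates satisfy $x_k\in\mathcal{H}_x^k$, $y_k\in\mathcal{H}_y^k$ (output $x^K\in\mathcal{H}_x^K$), where $\mathcal{H}_x^0=\mathcal{H}_y^0=\{0\}$, $$\mathcal{H}_y^{k+1}=\mathrm{Span}\{y_i,\nabla_yg(\widetilde x_i,\widetilde y_i):\ \widetilde x_i\in\mathcal{H}_x^i,\ y_i,\widetilde y_i\in\mathcal{H}_y^i,\ 1\le i\le k\},$$ and for $m=0,\dots,Q-1$, $$\mathcal{H}_x^{s_m}=\mathrm{Span}\Big\{x_i,\ \nabla_xf(\widetilde x_i,\widetilde y_i),\ \nabla_x\nabla_yg(x_i^t,y_i^t)\prod_{j=1}^t\big(I-\alpha\nabla_y^2g(x_{i,j}^t,y_{i,j}^t)\big)\nabla_yf(\hat x_i,\hat y_i)\Big\},$$ over $t=0,\dots,T$, $x_i,\widetilde x_i,\hat x_i,x_i^t,x_{i,j}^t\in\mathcal{H}_x^i$, $\widetilde y_i,\hat y_i,y_i^t,y_{i,j}^t\in\mathcal{H}_y^i$, $1\le i\le s_m-1$, $\alpha\in\mathbb{R}$; and $\mathcal{H}_x^n=\mathcal{H}_x^{s_m}$ for $s_m\le n\le s_{m+1}-1$, with $s_Q=K+1$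 (and $\mathcal{H}_x^n=\{0\}$ for $n<s_0$). Complexity: $\mathcal{C}_{\mathrm{norm}}(\mathcal{A},\epsilon)=\tau(n_J+n_H)+n_G$, with $\tau>0$ a universal constant and $n_J,n_H,n_G$ the total numbers of Jacobian-vector products, Hessian-vector products and gradient evaluations needed to find $\bar x$ with $\|\nabla\Phi(\bar x)\|\le\epsilon$; for an algorithm in the class with parameters $K,Q,T$, $n_J=Q$, $n_H=QT$, $n_G=K$. The statement is asymptotic in small $\epsilon,\mu_y$; $B$, $L_x,L_y,\widetilde L_{xy}$ and the bound on $\beta$ are treated as constants hidden in $\widetilde\Omega$, which may also hide logarithmic factors. *)

theory Defs
  imports Complex_Main "Jordan_Normal_Form.VS_Connect"
begin

section \<open>Euclidean calculus on \<open>carrier_vec n\<close>\<close>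

text \<open>The dimension is existentially quantified in the result, so it has to be a term and not a type.
  Elements of \<open>\<real>\<^sup>n\<close> are the vectors in \<open>carrier_vec n\<close>.\<close>

definition vnorm :: "real vec \<Rightarrow> real" where
  "vnorm v = sqrt (v \<bullet> v)"

definition opnorm :: "real mat \<Rightarrow> real" where
  "opnorm A = (SUP v \<in> {v \<in> carrier_vec (dim_col A). vnorm v \<le> 1}. vnorm (A *\<^sub>v v))"

abbreviation vspan :: "nat \<Rightarrow> real vec set \<Rightarrow> real vec set" where
  "vspan n \<equiv> LinearCombinations.module.span class_ring (module_vec TYPE(real) n)"

definition has_gradient :: "nat \<Rightarrow> (real vec \<Rightarrow> real) \<Rightarrow> real vec \<Rightarrow> real vec \<Rightarrow> bool" where
  "has_gradient n h v x \<longleftrightarrow> v \<in> carrier_vec n \<and>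
     (\<forall>e>0. \<exists>r>0. \<forall>u\<in>carrier_vec n. vnorm u < r \<longrightarrow>
        \<bar>h (x + u) - h x - v \<bullet> u\<bar> \<le> e * vnorm u)"

definition grad :: "nat \<Rightarrow> (real vec \<Rightarrow> real) \<Rightarrow> real vec \<Rightarrow> real vec" where
  "grad n h x = (THE v. has_gradient n h v x)"

definition has_jacobian ::
    "nat \<Rightarrow> nat \<Rightarrow> (real vec \<Rightarrow> real vec) \<Rightarrow> real mat \<Rightarrow> real vec \<Rightarrow> bool" where
  "has_jacobian n m F J x \<longleftrightarrow> J \<in> carrier_mat m n \<and>
     (\<forall>e>0. \<exists>r>0. \<forall>u\<in>carrier_vec n. vnorm u < r \<longrightarrow>
        vnorm (F (x + u) - F x - J *\<^sub>v u) \<le> e * vnorm u)"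

definition jacobian :: "nat \<Rightarrow> nat \<Rightarrow> (real vec \<Rightarrow> real vec) \<Rightarrow> real vec \<Rightarrow> real mat" where
  "jacobian n m F x = (THE J. has_jacobian n m F J x)"

type_synonym bifun = "real vec \<Rightarrow> real vec \<Rightarrow> real"

definition grad_x :: "nat \<Rightarrow> bifun \<Rightarrow> real vec \<Rightarrow> real vec \<Rightarrow> real vec" where
  "grad_x p h x y = grad p (\<lambda>x'. h x' y) x"

definition grad_y :: "nat \<Rightarrow> bifun \<Rightarrow> real vec \<Rightarrow> real vec \<Rightarrow> real vec" where
  "grad_y q h x y = grad q (h x) y"

text \<open>\<open>\<nabla>\<^sub>x\<nabla>\<^sub>y h\<close> is the \<open>p \<times> q\<close> matrix with entries \<open>\<partial>\<^sup>2h / \<partial>x\<^sub>i\<partial>y\<^sub>j\<close>, hence the transpose.\<close>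

definition grad_xy :: "nat \<Rightarrow> nat \<Rightarrow> bifun \<Rightarrow> real vec \<Rightarrow> real vec \<Rightarrow> real mat" where
  "grad_xy p q h x y = transpose_mat (jacobian p q (\<lambda>x'. grad_y q h x' y) x)"

definition hess_y :: "nat \<Rightarrow> bifun \<Rightarrow> real vec \<Rightarrow> real vec \<Rightarrow> real mat" where
  "hess_y q h x y = jacobian q q (grad_y q h x) y"

definition lipschitz_x :: "nat \<Rightarrow> nat \<Rightarrow> real \<Rightarrow> (real vec \<Rightarrow> real vec \<Rightarrow> real vec) \<Rightarrow> bool" where
  "lipschitz_x p q L F \<longleftrightarrow> (\<forall>x\<in>carrier_vec p. \<forall>x'\<in>carrier_vec p. \<forall>y\<in>carrier_vec q.
     vnorm (F x y - F x' y) \<le> L * vnorm (x - x'))"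

definition lipschitz_y :: "nat \<Rightarrow> nat \<Rightarrow> real \<Rightarrow> (real vec \<Rightarrow> real vec \<Rightarrow> real vec) \<Rightarrow> bool" where
  "lipschitz_y p q L F \<longleftrightarrow> (\<forall>x\<in>carrier_vec p. \<forall>y\<in>carrier_vec q. \<forall>y'\<in>carrier_vec q.
     vnorm (F x y - F x y') \<le> L * vnorm (y - y'))"

definition lipschitz_mat :: "nat \<Rightarrow> nat \<Rightarrow> real \<Rightarrow> (real vec \<Rightarrow> real vec \<Rightarrow> real mat) \<Rightarrow> bool" where
  "lipschitz_mat p q L F \<longleftrightarrow>
     (\<forall>x\<in>carrier_vec p. \<forall>x'\<in>carrier_vec p. \<forall>y\<in>carrier_vec q. \<forall>y'\<in>carrier_vec q.
       opnorm (F x y - F x' y') \<le> L * sqrt ((vnorm (x - x'))\<^sup>2 + (vnorm (y - y'))\<^sup>2))"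

definition convex_vec :: "nat \<Rightarrow> (real vec \<Rightarrow> real) \<Rightarrow> bool" where
  "convex_vec n h \<longleftrightarrow> (\<forall>u\<in>carrier_vec n. \<forall>v\<in>carrier_vec n. \<forall>t\<in>{0..1}.
     h (t \<cdot>\<^sub>v u + (1 - t) \<cdot>\<^sub>v v) \<le> t * h u + (1 - t) * h v)"

definition strongly_convex_vec :: "nat \<Rightarrow> real \<Rightarrow> (real vec \<Rightarrow> real) \<Rightarrow> bool" where
  "strongly_convex_vec n \<mu> h \<longleftrightarrow> (\<forall>u\<in>carrier_vec n. \<forall>v\<in>carrier_vec n. \<forall>t\<in>{0..1}.
     h (t \<cdot>\<^sub>v u + (1 - t) \<cdot>\<^sub>v v)
       \<le> t * h u + (1 - t) * h v - \<mu> / 2 * t * (1 - t) * (vnorm (u - v))\<^sup>2)"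


section \<open>Convex-strongly-convex bilevel problems\<close>

definition lower_sol :: "nat \<Rightarrow> bifun \<Rightarrow> real vec \<Rightarrow> real vec" where
  "lower_sol q g x = arg_min_on (g x) (carrier_vec q)"

definition upper_obj :: "nat \<Rightarrow> bifun \<Rightarrow> bifun \<Rightarrow> real vec \<Rightarrow> real" where
  "upper_obj q f g x = f x (lower_sol q g x)"

record csc_params =
  Lx :: real
  Lxy :: real
  Ly :: real
  Lxy_low :: real    \<comment> \<open>\<open>L\<^sub>x\<^sub>y\<close> and \<open>L\<^sub>y\<close> with a tilde: Lipschitz constants of \<open>\<nabla>\<^sub>y g\<close>\<close>
  Ly_low :: real
  rho_xy :: real
  rho_yy :: real
  sol_norm :: real   \<comment> \<open>the constant \<open>B\<close>\<close>
  mu_y :: real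

definition valid_params :: "csc_params \<Rightarrow> bool" where
  "valid_params P \<longleftrightarrow> 0 \<le> Lx P \<and> 0 \<le> Lxy P \<and> 0 \<le> Ly P \<and> 0 \<le> Lxy_low P \<and> 0 \<le> Ly_low P \<and>
     0 \<le> rho_xy P \<and> 0 \<le> rho_yy P \<and> 0 < sol_norm P \<and> 0 < mu_y P"

definition beta :: "csc_params \<Rightarrow> real" where
  "beta P = (Ly_low P - mu_y P) / 4"

definition csc_class :: "csc_params \<Rightarrow> nat \<Rightarrow> nat \<Rightarrow> bifun \<Rightarrow> bifun \<Rightarrow> bool" where
  "csc_class P p q f g \<longleftrightarrow> valid_params P \<and>
     (\<forall>x\<in>carrier_vec p. \<forall>y\<in>carrier_vec q.
        (\<exists>v. has_gradient p (\<lambda>x'. f x' y) v x) \<and>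
        (\<exists>v. has_gradient q (f x) v y) \<and>
        (\<exists>v. has_gradient q (g x) v y) \<and>
        (\<exists>J. has_jacobian p q (\<lambda>x'. grad_y q g x' y) J x) \<and>
        (\<exists>J. has_jacobian q q (grad_y q g x) J y)) \<and>
     lipschitz_x p q (Lx P) (grad_x p f) \<and> lipschitz_y p q (Lxy P) (grad_x p f) \<and>
     lipschitz_x p q (Lxy P) (grad_y q f) \<and> lipschitz_y p q (Ly P) (grad_y q f) \<and>
     lipschitz_x p q (Lxy_low P) (grad_y q g) \<and> lipschitz_y p q (Ly_low P) (grad_y q g) \<and>
     lipschitz_mat p q (rho_xy P) (grad_xy p q g) \<and>
     lipschitz_mat p q (rho_yy P) (hess_y q g) \<and>
     (\<exists>xopt. is_arg_min (upper_obj q f g) (\<lambda>x. x \<in> carrier_vec p) xopt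
        \<and> vnorm xopt = sol_norm P) \<and>
     convex_vec p (upper_obj q f g) \<and>
     (\<forall>x\<in>carrier_vec p. strongly_convex_vec q (mu_y P) (g x))"


section \<open>Hypergradient-based algorithms\<close>

definition y_gens :: "nat \<Rightarrow> bifun \<Rightarrow> real vec set \<Rightarrow> real vec set \<Rightarrow> real vec set" where
  "y_gens q g X Y = Y \<union> {grad_y q g x y | x y. x \<in> X \<and> y \<in> Y}"

definition x_gens ::
    "nat \<Rightarrow> nat \<Rightarrow> bifun \<Rightarrow> bifun \<Rightarrow> nat \<Rightarrow> real vec set \<Rightarrow> real vec set \<Rightarrow> real vec set" where
  "x_gens p q f g T X Y =
     X \<union> {grad_x p f x y | x y. x \<in> X \<and> y \<in> Y} \<union>
     {grad_xy p q g x y *\<^sub>v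
        (foldr (*) (map (\<lambda>(u, w). 1\<^sub>m q - \<alpha> \<cdot>\<^sub>m hess_y q g u w) zs) (1\<^sub>m q) *\<^sub>v grad_y q f x' y')
      | x y \<alpha> zs x' y'. x \<in> X \<and> y \<in> Y \<and> x' \<in> X \<and> y' \<in> Y \<and>
          length zs \<le> T \<and> set zs \<subseteq> X \<times> Y}"

text \<open>\<open>S\<close> is the set of iterations at which \<open>x\<close> is updated. Both spaces at level 1 are \<open>{0}\<close>, being
  spans of an empty set or unchanged.\<close>

fun Hx :: "nat \<Rightarrow> nat \<Rightarrow> bifun \<Rightarrow> bifun \<Rightarrow> nat \<Rightarrow> nat set \<Rightarrow> nat \<Rightarrow> real vec set"
and Hy :: "nat \<Rightarrow> nat \<Rightarrow> bifun \<Rightarrow> bifun \<Rightarrow> nat \<Rightarrow> nat set \<Rightarrow> nat \<Rightarrow> real vec set" where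
  "Hx p q f g T S 0 = {0\<^sub>v p}"
| "Hx p q f g T S (Suc n) =
     (if Suc n \<in> S
      then vspan p (\<Union>i\<in>{1..n}. x_gens p q f g T (Hx p q f g T S i) (Hy p q f g T S i))
      else Hx p q f g T S n)"
| "Hy p q f g T S 0 = {0\<^sub>v q}"
| "Hy p q f g T S (Suc n) =
     vspan q (\<Union>i\<in>{1..n}. y_gens q g (Hx p q f g T S i) (Hy p q f g T S i))"

text \<open>\<open>K\<close> iterations, with \<open>x\<close> updated at the \<open>Q\<close> iterations \<open>s 0 < \<dots> < s (Q - 1) \<le> K\<close>.\<close>

definition hypergradient_run ::
    "nat \<Rightarrow> nat \<Rightarrow> bifun \<Rightarrow> bifun \<Rightarrow> nat \<Rightarrow> nat \<Rightarrow> nat \<Rightarrow> (nat \<Rightarrow> nat)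
     \<Rightarrow> (nat \<Rightarrow> real vec) \<Rightarrow> (nat \<Rightarrow> real vec) \<Rightarrow> bool" where
  "hypergradient_run p q f g K Q T s xs ys \<longleftrightarrow>
     strict_mono_on {..<Q} s \<and> (\<forall>m<Q. s m \<le> K) \<and>
     (\<forall>k\<le>K. xs k \<in> Hx p q f g T (s ` {..<Q}) k \<and> ys k \<in> Hy p q f g T (s ` {..<Q}) k)"

text \<open>\<open>n\<^sub>J = Q\<close> Jacobian-vector products, \<open>n\<^sub>H = Q T\<close> Hessian-vector products and \<open>n\<^sub>G = K\<close> gradients.\<close>

definition C_norm :: "real \<Rightarrow> nat \<Rightarrow> nat \<Rightarrow> nat \<Rightarrow> real" where
  "C_norm \<tau> K Q T = \<tau> * (real Q + real (Q * T)) + real K"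

end

theory Submission
  imports Defs
begin

text \<open>Take \<open>g x y = \<mu>/2 |y|\<^sup>2 - y \<bullet> C x\<close> and \<open>f x y = l/2 |y|\<^sup>2 - l/\<mu> (C xopt) \<bullet> y\<close> with \<open>C\<close> equal to \<open>a\<close>
  times the matrix of backward differences and \<open>xopt\<close> constant with norm \<open>B\<close>. Then
  \<open>y\<^sup>*(x) = C x / \<mu>\<close>, and up to a constant \<open>\<Phi>(x) = l / (2 \<mu>\<^sup>2) |C (x - xopt)|\<^sup>2\<close>, which has
  smoothness of order \<open>1 / \<mu>\<^sup>2\<close> even though \<open>\<nabla>\<^sub>y\<^sup>2 g = \<mu> I\<close>. Hessian-vector products are
  therefore useless, and since \<open>C\<close> is bidiagonal and \<open>C xopt\<close> is a multiple of the first unit vector,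
  after \<open>K\<close> iterations only the first \<open>K\<close> coordinates can be nonzero. For \<open>w = (1, \<dots>, d)\<close> the vector
  \<open>C w\<close> is constant, so \<open>C w \<bullet> C (x - xopt)\<close> telescopes to \<open>a\<^sup>2\<close> times the last coordinate of
  \<open>x - xopt\<close>; while \<open>K < d\<close> this coordinate is \<open>- B / sqrt d\<close>, and Cauchy--Schwarz gives
  \<open>|\<nabla>\<Phi>(x)| \<ge> l a\<^sup>2 B / (\<mu>\<^sup>2 d\<^sup>2)\<close>. The largest \<open>d\<close> for which this exceeds \<open>\<epsilon>\<close> is of order
  \<open>1 / (\<mu> sqrt \<epsilon>)\<close>, which bounds \<open>K\<close> and hence the complexity from
  below.\<close>

section \<open>Norm and inner product on \<open>carrier_vec n\<close>\<close>

lemma vnorm_ge_0 [simp]: "0 \<le> vnorm v"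
  by (simp add: vnorm_def scalar_prod_def sum_nonneg)

lemma scalar_prod_self: "v \<bullet> v = (vnorm v)\<^sup>2"
  by (simp add: vnorm_def scalar_prod_def sum_nonneg)

lemma vnorm_square: "(vnorm v)\<^sup>2 = (\<Sum>i<dim_vec v. (v $ i)\<^sup>2)"
  by (simp add: vnorm_def scalar_prod_def sum_nonneg power2_eq_square[of "v $ _"] lessThan_atLeast0)

lemma vnorm_smult [simp]: "vnorm (c \<cdot>\<^sub>v v) = \<bar>c\<bar> * vnorm v"
  by (simp add: vnorm_def real_sqrt_mult mult.assoc[symmetric])

lemma vnorm_zero [simp]: "vnorm (0\<^sub>v n) = 0"
  by (simp add: vnorm_def)

lemma vnorm_unit_vec [simp]: "i < n \<Longrightarrow> vnorm (unit_vec n i) = 1"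
  by (simp add: vnorm_def)

lemma vnorm_eq_0_iff:
  assumes "v \<in> carrier_vec n"
  shows "vnorm v = 0 \<longleftrightarrow> v = 0\<^sub>v n"
proof
  assume "vnorm v = 0"
  then have "(\<Sum>i\<in>{0..<n}. v $ i * v $ i) = 0"
    using assms by (simp add: vnorm_def scalar_prod_def)
  then have "\<forall>i<n. v $ i = 0"
    by (subst (asm) sum_nonneg_eq_0_iff) auto
  then show "v = 0\<^sub>v n"
    using assms by (intro eq_vecI) auto
qed simp

lemma abs_index_le_vnorm:
  assumes "i < dim_vec v"
  shows "\<bar>v $ i\<bar> \<le> vnorm v"
proof -
  have "(v $ i)\<^sup>2 \<le> v \<bullet> v"
    unfolding scalar_prod_def power2_eq_square
    using assms by (intro member_le_sum) auto
  then show ?thesis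
    by (simp add: vnorm_def real_le_rsqrt)
qed

lemma vnorm_add_square:
  assumes "u \<in> carrier_vec n" "v \<in> carrier_vec n"
  shows "(vnorm (u + v))\<^sup>2 = (vnorm u)\<^sup>2 + 2 * (u \<bullet> v) + (vnorm v)\<^sup>2"
  using assms
  by (simp add: scalar_prod_self[symmetric] scalar_prod_add_distrib[of _ n]
      add_scalar_prod_distrib[of _ n] comm_scalar_prod[of v n u])

lemma vnorm_minus_square:
  assumes "u \<in> carrier_vec n" "v \<in> carrier_vec n"
  shows "(vnorm (u - v))\<^sup>2 = (vnorm u)\<^sup>2 - 2 * (u \<bullet> v) + (vnorm v)\<^sup>2"
  using assms
  by (simp add: scalar_prod_self[symmetric] scalar_prod_minus_distrib[of _ n]
      minus_scalar_prod_distrib[of _ n] comm_scalar_prod[of v n u])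

text \<open>An exact identity, obtained by expanding the squares. It serves twice: for convexity of
  the upper objective and for strong convexity of the lower one.\<close>

lemma vnorm_convex_combination:
  assumes "u \<in> carrier_vec n" "v \<in> carrier_vec n"
  shows "(vnorm (t \<cdot>\<^sub>v u + (1 - t) \<cdot>\<^sub>v v))\<^sup>2 =
    t * (vnorm u)\<^sup>2 + (1 - t) * (vnorm v)\<^sup>2 - t * (1 - t) * (vnorm (u - v))\<^sup>2"
  using assms
  by (subst vnorm_add_square[of _ n]; (subst vnorm_minus_square[of _ n])?)
    (auto simp: power_mult_distrib, simp add: algebra_simps power2_eq_square)

lemma Cauchy_Schwarz_vnorm:
  assumes u: "u \<in> carrier_vec n" and v: "v \<in> carrier_vec n"
  shows "\<bar>u \<bullet> v\<bar> \<le> vnorm u * vnorm v"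
proof (cases "vnorm v = 0")
  case True
  then show ?thesis
    using u v by (simp add: vnorm_eq_0_iff[OF v])
next
  case False
  define s where "s = (vnorm v)\<^sup>2"
  have s: "s > 0"
    using False by (simp add: s_def)
  \<comment> \<open>This vector is \<open>s\<close> times the component of \<open>u\<close>
    orthogonal to \<open>v\<close>; the factor \<open>s\<close> avoids a division.\<close>
  have "0 \<le> (vnorm (s \<cdot>\<^sub>v u - (u \<bullet> v) \<cdot>\<^sub>v v))\<^sup>2"
    by simp
  also have "\<dots> = s * (s * (vnorm u)\<^sup>2 - (u \<bullet> v)\<^sup>2)"
    using u v s
    by (subst vnorm_minus_square[of _ n])
      (auto simp: power_mult_distrib s_def[symmetric], simp add: algebra_simps power2_eq_square)
  finally have "(u \<bullet> v)\<^sup>2 \<le> (vnorm u * vnorm v)\<^sup>2"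
    using s by (simp add: zero_le_mult_iff s_def power_mult_distrib mult.commute)
  then show ?thesis
    using abs_le_square_iff[of "u \<bullet> v" "vnorm u * vnorm v"] by simp
qed

section \<open>Gradients and Jacobians\<close>

lemma has_gradient_unique:
  assumes "has_gradient n h v x" "has_gradient n h w x"
  shows "v = w"
proof (rule ccontr)
  have v: "v \<in> carrier_vec n" and w: "w \<in> carrier_vec n"
    using assms by (auto simp: has_gradient_def)
  assume "v \<noteq> w"
  then obtain i where i: "i < n" "v $ i \<noteq> w $ i"
    using v w by (metis carrier_vecD eq_vecI)
  \<comment> \<open>A quarter of the gap: along \<open>unit_vec n i\<close> the two first-order
    errors add up to at most half of the gap, a contradiction.\<close>
  define e where "e = \<bar>v $ i - w $ i\<bar> / 4"
  have e: "e > 0"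
    using i by (simp add: e_def)
  obtain r where r: "r > 0" "\<And>u. u \<in> carrier_vec n \<Longrightarrow> vnorm u < r \<Longrightarrow>
      \<bar>h (x + u) - h x - v \<bullet> u\<bar> \<le> e * vnorm u"
    using assms(1) e unfolding has_gradient_def by metis
  obtain r' where r': "r' > 0" "\<And>u. u \<in> carrier_vec n \<Longrightarrow> vnorm u < r' \<Longrightarrow>
      \<bar>h (x + u) - h x - w \<bullet> u\<bar> \<le> e * vnorm u"
    using assms(2) e unfolding has_gradient_def by metis
  define t where "t = min r r' / 2"
  have t: "t > 0" "t < r" "t < r'"
    using r(1) r'(1) by (auto simp: t_def)
  have "\<bar>v $ i * t - w $ i * t\<bar> \<le> 2 * (e * t)"
    using r(2)[of "t \<cdot>\<^sub>v unit_vec n i"] r'(2)[of "t \<cdot>\<^sub>v unit_vec n i"] t v w i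
    by (auto simp: mult.commute)
  then have "\<bar>v $ i - w $ i\<bar> * t \<le> 2 * e * t"
    using t by (simp add: left_diff_distrib[symmetric] abs_mult)
  then show False
    using t i by (simp add: e_def mult_le_0_iff)
qed

text \<open>\<open>grad\<close> is a definite description, so uniqueness is what turns an exhibited
  gradient into its value.\<close>

lemma grad_eqI: "has_gradient n h v x \<Longrightarrow> grad n h x = v"
  unfolding grad_def by (blast intro: has_gradient_unique)

text \<open>The functions differentiated below are at most quadratic, so their first-order remainder
  is bounded by a multiple of the squared increment, which is of lower order than the
  increment.\<close>

lemma has_gradient_quadratic_remainder:
  assumes v: "v \<in> carrier_vec n"
    and rem: "\<And>u. u \<in> carrier_vec n \<Longrightarrow> \<bar>h (x + u) - h x - v \<bullet> u\<bar> \<le> c * (vnorm u)\<^sup>2"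
  shows "has_gradient n h v x"
  unfolding has_gradient_def
proof (intro conjI v allI impI)
  fix e :: real
  assume e: "e > 0"
  show "\<exists>r>0. \<forall>u\<in>carrier_vec n. vnorm u < r \<longrightarrow>
      \<bar>h (x + u) - h x - v \<bullet> u\<bar> \<le> e * vnorm u"
  proof (intro exI conjI ballI impI)
    \<comment> \<open>The \<open>+ 1\<close> keeps the radius meaningful for \<open>c = 0\<close>,
      and the absolute value covers negative \<open>c\<close>.\<close>
    show "0 < e / (\<bar>c\<bar> + 1)"
      using e by simp
    fix u
    assume u: "u \<in> carrier_vec n" "vnorm u < e / (\<bar>c\<bar> + 1)"
    have "c * vnorm u \<le> (\<bar>c\<bar> + 1) * vnorm u"
      by (intro mult_right_mono) auto
    also have "\<dots> \<le> e"
      using u(2) by (simp add: field_simps)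
    finally have "c * (vnorm u)\<^sup>2 \<le> e * vnorm u"
      by (simp add: power2_eq_square mult.assoc[symmetric] mult_right_mono)
    then show "\<bar>h (x + u) - h x - v \<bullet> u\<bar> \<le> e * vnorm u"
      using rem[OF u(1)] by linarith
  qed
qed

text \<open>A coordinate of the error vector is at most its norm, so first-order accuracy passes to
  components. This reduces uniqueness of Jacobians to uniqueness of gradients.\<close>

lemma has_jacobian_row:
  assumes J: "has_jacobian n m F J x" and i: "i < m"
    and F: "\<And>u. u \<in> carrier_vec n \<Longrightarrow> F (x + u) \<in> carrier_vec m" "F x \<in> carrier_vec m"
  shows "has_gradient n (\<lambda>x. F x $ i) (row J i) x"
  unfolding has_gradient_def
proof (intro conjI allI impI)
  have J': "J \<in> carrier_mat m n"
    using J by (simp add: has_jacobian_def)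
  then show "row J i \<in> carrier_vec n"
    using i by (intro row_carrier_vec)
  fix e :: real
  assume "e > 0"
  then obtain r where r: "r > 0" "\<And>u. u \<in> carrier_vec n \<Longrightarrow> vnorm u < r \<Longrightarrow>
      vnorm (F (x + u) - F x - J *\<^sub>v u) \<le> e * vnorm u"
    using J unfolding has_jacobian_def by metis
  show "\<exists>r>0. \<forall>u\<in>carrier_vec n. vnorm u < r \<longrightarrow>
      \<bar>F (x + u) $ i - F x $ i - row J i \<bullet> u\<bar> \<le> e * vnorm u"
  proof (intro exI conjI ballI impI)
    fix u
    assume u: "u \<in> carrier_vec n" "vnorm u < r"
    have "\<bar>(F (x + u) - F x - J *\<^sub>v u) $ i\<bar> \<le> vnorm (F (x + u) - F x - J *\<^sub>v u)"
      using J' i by (intro abs_index_le_vnorm) auto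
    also have "\<dots> \<le> e * vnorm u"
      using r(2)[OF u] .
    finally show "\<bar>F (x + u) $ i - F x $ i - row J i \<bullet> u\<bar> \<le> e * vnorm u"
      using J' i F u by auto
  qed (rule r(1))
qed

lemma has_jacobian_unique:
  assumes "has_jacobian n m F J x" "has_jacobian n m F J' x"
    and "\<And>u. u \<in> carrier_vec n \<Longrightarrow> F (x + u) \<in> carrier_vec m" "F x \<in> carrier_vec m"
  shows "J = J'"
proof (rule eq_rowI)
  have J: "J \<in> carrier_mat m n" "J' \<in> carrier_mat m n"
    using assms by (auto simp: has_jacobian_def)
  then show "dim_row J = dim_row J'" "dim_col J = dim_col J'"
    by auto
  fix i
  assume "i < dim_row J'"
  then have "i < m"
    using J by simp
  then show "row J i = row J' i"
    using assms
    by (intro has_gradient_unique[OF has_jacobian_row[of n m F] has_jacobian_row[of n m F]]) auto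
qed

lemma has_jacobian_affine:
  assumes J: "J \<in> carrier_mat m n"
    and F: "\<And>u. u \<in> carrier_vec n \<Longrightarrow> F (x + u) = F x + J *\<^sub>v u" "F x \<in> carrier_vec m"
  shows "has_jacobian n m F J x"
  unfolding has_jacobian_def
proof (intro conjI J allI impI)
  fix e :: real
  assume e: "e > 0"
  have "F (x + u) - F x - J *\<^sub>v u = 0\<^sub>v m" if "u \<in> carrier_vec n" for u
    using J that F by (intro eq_vecI) auto
  then show "\<exists>r>0. \<forall>u\<in>carrier_vec n. vnorm u < r \<longrightarrow>
      vnorm (F (x + u) - F x - J *\<^sub>v u) \<le> e * vnorm u"
    using e by (intro exI[of _ 1]) simp
qed

lemma jacobian_affine:
  assumes J: "J \<in> carrier_mat m n"
    and F: "\<And>u. u \<in> carrier_vec n \<Longrightarrow> F (x + u) = F x + J *\<^sub>v u" "F x \<in> carrier_vec m"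
  shows "jacobian n m F x = J"
proof -
  have "has_jacobian n m F J x"
    using has_jacobian_affine[OF assms] .
  then show ?thesis
    unfolding jacobian_def using J F
    by (intro the_equality) (auto intro!: has_jacobian_unique[of n m F _ x J])
qed

text \<open>The second-derivative matrices of the instance are constant, so both
  \<open>lipschitz_mat\<close> conditions reduce to this value.\<close>

lemma opnorm_zero: "opnorm (0\<^sub>m m n) = 0"
proof -
  have zero_mult: "0\<^sub>m m n *\<^sub>v v = 0\<^sub>v m" if "v \<in> carrier_vec n" for v :: "real vec"
    using that by (intro eq_vecI) auto
  \<comment> \<open>The supremum of a constant family equals the constant only over a nonempty
    set.\<close>
  have "0\<^sub>v n \<in> {v \<in> carrier_vec n. vnorm v \<le> 1}"
    by simp
  then have "opnorm (0\<^sub>m m n) = (SUP v \<in> {v \<in> carrier_vec n. vnorm v \<le> 1}. 0)"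
    unfolding opnorm_def by (intro SUP_cong) (auto simp: zero_mult)
  also have "\<dots> = 0"
    using \<open>0\<^sub>v n \<in> _\<close> by (intro cSUP_const) blast
  finally show ?thesis .
qed


section \<open>Vectors whose coordinates vanish from an index on\<close>

definition zero_from :: "nat \<Rightarrow> nat \<Rightarrow> real vec set" where
  "zero_from d n = {v \<in> carrier_vec d. \<forall>j. n \<le> j \<longrightarrow> j < d \<longrightarrow> v $ j = 0}"

lemma zero_from_carrier: "v \<in> zero_from d n \<Longrightarrow> v \<in> carrier_vec d"
  by (simp add: zero_from_def)

lemma zero_from_mono: "m \<le> n \<Longrightarrow> zero_from d m \<subseteq> zero_from d n"
  by (auto simp: zero_from_def)

lemma zero_vec_in_zero_from [simp]: "0\<^sub>v d \<in> zero_from d n"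
  by (simp add: zero_from_def)

lemma smult_in_zero_from: "v \<in> zero_from d n \<Longrightarrow> c \<cdot>\<^sub>v v \<in> zero_from d n"
  by (auto simp: zero_from_def)

lemma minus_in_zero_from:
  "u \<in> zero_from d n \<Longrightarrow> v \<in> zero_from d n \<Longrightarrow> u - v \<in> zero_from d n"
  by (auto simp: zero_from_def)

text \<open>Coordinate \<open>j\<close> of a finite linear combination is the same combination of
  the coordinates \<open>j\<close> of its members, all of which are zero.\<close>

lemma vspan_subset_zero_from:
  assumes S: "S \<subseteq> zero_from d n"
  shows "vspan d S \<subseteq> zero_from d n"
proof
  interpret vec_space "TYPE(real)" d .
  fix v
  assume "v \<in> vspan d S"
  then obtain a A where A: "finite A" "A \<subseteq> S" and v: "v = lincomb a A"
    by (auto simp: span_def)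
  have A': "A \<subseteq> carrier_vec d"
    using A S by (auto simp: zero_from_def)
  have "lincomb a A $ j = 0" if "n \<le> j" "j < d" for j
    unfolding lincomb_index[OF that(2) A']
    using A S that by (intro sum.neutral) (auto simp: zero_from_def)
  then show "v \<in> zero_from d n"
    using lincomb_dim[OF A(1) A'] by (auto simp: v zero_from_def intro!: carrier_vecI)
qed

section \<open>The quadratic bilevel problem for a general coupling matrix\<close>

locale quadratic_bilevel =
  fixes d :: nat and C :: "real mat" and \<mu> ly L :: real and xopt :: "real vec"
  assumes C: "C \<in> carrier_mat d d" and \<mu>: "0 < \<mu>" and ly: "0 < ly"
    and C_le: "\<And>v. v \<in> carrier_vec d \<Longrightarrow> vnorm (C *\<^sub>v v) \<le> L * vnorm v"
    and xopt: "xopt \<in> carrier_vec d"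
begin

text \<open>The linear term places the minimizer in \<open>y\<close> at
  \<open>C *\<^sub>v xopt\<close> scaled by \<open>1 / \<mu>\<close>, which is the lower-level
  solution at \<open>xopt\<close>; this centers the composed objective at
  \<open>xopt\<close>.\<close>

definition upper :: bifun where
  "upper x y = ly / 2 * (y \<bullet> y) - ly / \<mu> * ((C *\<^sub>v xopt) \<bullet> y)"

definition lower :: bifun where
  "lower x y = \<mu> / 2 * (y \<bullet> y) - y \<bullet> (C *\<^sub>v x)"

lemma C_mult_carrier [simp]: "C *\<^sub>v v \<in> carrier_vec d"
  using C by (intro carrier_vecI) auto

lemma dim_C [simp]: "dim_row C = d" "dim_col C = d"
  using C by auto

lemma has_grad_x_upper: "has_gradient d (\<lambda>x'. upper x' y) (0\<^sub>v d) x"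
  by (rule has_gradient_quadratic_remainder[of _ _ _ _ 0]) (auto simp: upper_def)

lemma has_grad_y_upper:
  assumes y: "y \<in> carrier_vec d"
  shows "has_gradient d (upper x) (ly \<cdot>\<^sub>v y - (ly / \<mu>) \<cdot>\<^sub>v (C *\<^sub>v xopt)) y"
proof (rule has_gradient_quadratic_remainder[of _ _ _ _ "ly / 2"])
  fix u :: "real vec"
  assume u: "u \<in> carrier_vec d"
  have eq: "upper x (y + u) - upper x y - (ly \<cdot>\<^sub>v y - (ly / \<mu>) \<cdot>\<^sub>v (C *\<^sub>v xopt)) \<bullet> u
      = ly / 2 * (vnorm u)\<^sup>2"
    using y u
    by (simp add: upper_def scalar_prod_self vnorm_add_square[of _ d] scalar_prod_add_distrib[of _ d]
        minus_scalar_prod_distrib[of _ d]) (simp add: algebra_simps add_divide_distrib)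
  show "\<bar>upper x (y + u) - upper x y - (ly \<cdot>\<^sub>v y - (ly / \<mu>) \<cdot>\<^sub>v (C *\<^sub>v xopt)) \<bullet> u\<bar>
      \<le> ly / 2 * (vnorm u)\<^sup>2"
    unfolding eq using ly by simp
qed (use y in auto)

lemma has_grad_y_lower:
  assumes y: "y \<in> carrier_vec d"
  shows "has_gradient d (lower x) (\<mu> \<cdot>\<^sub>v y - C *\<^sub>v x) y"
proof (rule has_gradient_quadratic_remainder[of _ _ _ _ "\<mu> / 2"])
  fix u :: "real vec"
  assume u: "u \<in> carrier_vec d"
  have eq: "lower x (y + u) - lower x y - (\<mu> \<cdot>\<^sub>v y - C *\<^sub>v x) \<bullet> u = \<mu> / 2 * (vnorm u)\<^sup>2"
    using y u
    by (simp add: lower_def scalar_prod_self vnorm_add_square[of _ d] add_scalar_prod_distrib[of _ d]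
        minus_scalar_prod_distrib[of _ d] comm_scalar_prod[of u d "C *\<^sub>v x"])
      (simp add: algebra_simps)
  show "\<bar>lower x (y + u) - lower x y - (\<mu> \<cdot>\<^sub>v y - C *\<^sub>v x) \<bullet> u\<bar> \<le> \<mu> / 2 * (vnorm u)\<^sup>2"
    unfolding eq using \<mu> by simp
qed (use y in auto)

lemma grad_x_upper: "grad_x d upper x y = 0\<^sub>v d"
  unfolding grad_x_def by (rule grad_eqI[OF has_grad_x_upper])

lemma grad_y_upper:
  "y \<in> carrier_vec d \<Longrightarrow> grad_y d upper x y = ly \<cdot>\<^sub>v y - (ly / \<mu>) \<cdot>\<^sub>v (C *\<^sub>v xopt)"
  unfolding grad_y_def by (rule grad_eqI[OF has_grad_y_upper])

lemma grad_y_lower: "y \<in> carrier_vec d \<Longrightarrow> grad_y d lower x y = \<mu> \<cdot>\<^sub>v y - C *\<^sub>v x"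
  unfolding grad_y_def by (rule grad_eqI[OF has_grad_y_lower])

lemma grad_y_lower_affine_x:
  assumes "x \<in> carrier_vec d" "y \<in> carrier_vec d" "u \<in> carrier_vec d"
  shows "grad_y d lower (x + u) y = grad_y d lower x y + (- C) *\<^sub>v u"
  using assms C
  by (intro eq_vecI) (auto simp: grad_y_lower mult_add_distrib_mat_vec[of _ d d])

lemma grad_y_lower_affine_y:
  assumes "y \<in> carrier_vec d" "u \<in> carrier_vec d"
  shows "grad_y d lower x (y + u) = grad_y d lower x y + (\<mu> \<cdot>\<^sub>m 1\<^sub>m d) *\<^sub>v u"
  using assms
  by (intro eq_vecI) (auto simp: grad_y_lower algebra_simps)

lemma grad_y_lower_carrier: "y \<in> carrier_vec d \<Longrightarrow> grad_y d lower x y \<in> carrier_vec d"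
  by (simp add: grad_y_lower)

lemma grad_xy_lower:
  assumes "x \<in> carrier_vec d" "y \<in> carrier_vec d"
  shows "grad_xy d d lower x y = transpose_mat (- C)"
  unfolding grad_xy_def using assms C
  by (subst jacobian_affine[of "- C"]) (auto simp: grad_y_lower_affine_x grad_y_lower_carrier)

lemma hess_y_lower:
  assumes "y \<in> carrier_vec d"
  shows "hess_y d lower x y = \<mu> \<cdot>\<^sub>m 1\<^sub>m d"
  unfolding hess_y_def using assms
  by (intro jacobian_affine) (auto simp: grad_y_lower_affine_y grad_y_lower_carrier)

lemma lower_complete_square:
  assumes x: "x \<in> carrier_vec d" and y: "y \<in> carrier_vec d"
  shows "lower x y = \<mu> / 2 * (vnorm (y - (1 / \<mu>) \<cdot>\<^sub>v (C *\<^sub>v x)))\<^sup>2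
    - (vnorm (C *\<^sub>v x))\<^sup>2 / (2 * \<mu>)"
  using x y \<mu>
  by (simp add: lower_def scalar_prod_self vnorm_minus_square[of _ d] power_mult_distrib)
    (simp add: field_simps power2_eq_square)

text \<open>\<open>arg_min_on\<close> picks some minimizer by choice, so its value is determined
  only once all other points are strictly worse. The completed square gives this strictness.\<close>

lemma lower_sol_lower:
  assumes x: "x \<in> carrier_vec d"
  shows "lower_sol d lower x = (1 / \<mu>) \<cdot>\<^sub>v (C *\<^sub>v x)"
proof -
  let ?y = "(1 / \<mu>) \<cdot>\<^sub>v (C *\<^sub>v x)"
  have y: "?y \<in> carrier_vec d"
    by simp
  have less: "lower x ?y < lower x z" if z: "z \<in> carrier_vec d" "z \<noteq> ?y" for z
  proof -
    have "z - ?y \<noteq> 0\<^sub>v d"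
    proof
      assume *: "z - ?y = 0\<^sub>v d"
      have "z = (z - ?y) + ?y"
        using z(1) by (intro eq_vecI) auto
      then show False
        using z(2) unfolding * by simp
    qed
    then have "vnorm (z - ?y) > 0"
      using vnorm_eq_0_iff[of "z - ?y" d] z(1) vnorm_ge_0[of "z - ?y"] by (auto simp: less_le)
    then show ?thesis
      using x z(1) \<mu> by (simp add: lower_complete_square minus_cancel_vec[of _ d])
  qed
  have "is_arg_min (lower x) (\<lambda>z. z \<in> carrier_vec d) z \<longleftrightarrow> z = ?y" for z
    unfolding is_arg_min_def using y less by (metis less_irrefl less_trans)
  then show ?thesis
    unfolding lower_sol_def arg_min_on_def arg_min_def by (intro some_equality) auto
qed

text \<open>After inserting the lower-level solution, the linear term of \<open>upper\<close>
  becomes the cross term of a square centered at \<open>xopt\<close>; the subtracted constant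
  completes that square.\<close>

lemma upper_obj_eq:
  assumes x: "x \<in> carrier_vec d"
  shows "upper_obj d upper lower x =
    ly / (2 * \<mu>\<^sup>2) * ((vnorm (C *\<^sub>v (x - xopt)))\<^sup>2 - (vnorm (C *\<^sub>v xopt))\<^sup>2)"
  using x xopt \<mu> C
  by (simp add: upper_obj_def lower_sol_lower upper_def scalar_prod_self power_mult_distrib
      mult_minus_distrib_mat_vec[of _ d d] vnorm_minus_square[of _ d]
      comm_scalar_prod[of "C *\<^sub>v x" d "C *\<^sub>v xopt"])
    (simp add: field_simps power2_eq_square)

text \<open>The remainder is exactly the quadratic form at \<open>u\<close>, and \<open>L\<close>
  enters through the bound on \<open>C *\<^sub>v u\<close>.\<close>

lemma has_gradient_upper_obj:
  assumes x: "x \<in> carrier_vec d"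
  shows "has_gradient d (upper_obj d upper lower)
    ((ly / \<mu>\<^sup>2) \<cdot>\<^sub>v (transpose_mat C *\<^sub>v (C *\<^sub>v (x - xopt)))) x"
proof (rule has_gradient_quadratic_remainder[of _ _ _ _ "ly / (2 * \<mu>\<^sup>2) * L\<^sup>2"])
  fix u :: "real vec"
  assume u: "u \<in> carrier_vec d"
  have "x + u - xopt = (x - xopt) + u"
    using x u xopt by (intro eq_vecI) auto
  then have *: "C *\<^sub>v (x + u - xopt) = C *\<^sub>v (x - xopt) + C *\<^sub>v u"
    using C x u xopt by (simp add: mult_add_distrib_mat_vec[of _ d d])
  have "(transpose_mat C *\<^sub>v (C *\<^sub>v (x - xopt))) \<bullet> u = (C *\<^sub>v (x - xopt)) \<bullet> (C *\<^sub>v u)"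
    using transpose_vec_mult_scalar[OF C u, of "C *\<^sub>v (x - xopt)"] by simp
  then have eq: "upper_obj d upper lower (x + u) - upper_obj d upper lower x
      - ((ly / \<mu>\<^sup>2) \<cdot>\<^sub>v (transpose_mat C *\<^sub>v (C *\<^sub>v (x - xopt)))) \<bullet> u
      = ly / (2 * \<mu>\<^sup>2) * (vnorm (C *\<^sub>v u))\<^sup>2"
    using x u C 
    by (simp add: upper_obj_eq * vnorm_add_square[of _ d])
      (simp add: algebra_simps add_divide_distrib diff_divide_distrib)
  have "(vnorm (C *\<^sub>v u))\<^sup>2 \<le> (L * vnorm u)\<^sup>2"
    using C_le[OF u] by (intro power_mono) auto
  then show "\<bar>upper_obj d upper lower (x + u) - upper_obj d upper lower x
      - ((ly / \<mu>\<^sup>2) \<cdot>\<^sub>v (transpose_mat C *\<^sub>v (C *\<^sub>v (x - xopt)))) \<bullet> u\<bar>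
      \<le> ly / (2 * \<mu>\<^sup>2) * L\<^sup>2 * (vnorm u)\<^sup>2"
    unfolding eq using ly \<mu> by (simp add: power_mult_distrib mult.assoc divide_right_mono mult_left_mono)
qed (use C in auto)

text \<open>Any test vector \<open>w\<close> bounds the gradient norm from below by Cauchy--Schwarz.
  Moving the transpose across the inner product leaves a quantity that a suitable \<open>w\<close>
  makes explicit.\<close>

lemma vnorm_grad_upper_obj_ge:
  assumes x: "x \<in> carrier_vec d" and w: "w \<in> carrier_vec d"
  shows "ly / \<mu>\<^sup>2 * \<bar>(C *\<^sub>v w) \<bullet> (C *\<^sub>v (x - xopt))\<bar>
    \<le> vnorm (grad d (upper_obj d upper lower) x) * vnorm w"
proof -
  let ?G = "transpose_mat C *\<^sub>v (C *\<^sub>v (x - xopt))"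
  have G: "?G \<in> carrier_vec d"
    using C by auto
  have "?G \<bullet> w = (C *\<^sub>v w) \<bullet> (C *\<^sub>v (x - xopt))"
    using transpose_vec_mult_scalar[OF C w, of "C *\<^sub>v (x - xopt)"]
      comm_scalar_prod[of "C *\<^sub>v w" d "C *\<^sub>v (x - xopt)"] by simp
  then have "ly / \<mu>\<^sup>2 * \<bar>(C *\<^sub>v w) \<bullet> (C *\<^sub>v (x - xopt))\<bar> = \<bar>((ly / \<mu>\<^sup>2) \<cdot>\<^sub>v ?G) \<bullet> w\<bar>"
    using ly G w by (simp add: abs_mult)
  also have "\<dots> \<le> vnorm ((ly / \<mu>\<^sup>2) \<cdot>\<^sub>v ?G) * vnorm w"
    using G w by (intro Cauchy_Schwarz_vnorm[of _ d]) auto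
  finally show ?thesis
    using grad_eqI[OF has_gradient_upper_obj[OF x]] by simp
qed

lemma convex_upper_obj: "convex_vec d (upper_obj d upper lower)"
  unfolding convex_vec_def
proof (intro ballI)
  fix u v :: "real vec" and t :: real
  assume u: "u \<in> carrier_vec d" and v: "v \<in> carrier_vec d" and t: "t \<in> {0..1}"
  have "t \<cdot>\<^sub>v u + (1 - t) \<cdot>\<^sub>v v - xopt = t \<cdot>\<^sub>v (u - xopt) + (1 - t) \<cdot>\<^sub>v (v - xopt)"
    using u v xopt by (intro eq_vecI) (auto simp: algebra_simps)
  then have "C *\<^sub>v (t \<cdot>\<^sub>v u + (1 - t) \<cdot>\<^sub>v v - xopt)
      = t \<cdot>\<^sub>v (C *\<^sub>v (u - xopt)) + (1 - t) \<cdot>\<^sub>v (C *\<^sub>v (v - xopt))"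
    using C u v xopt by (simp add: mult_add_distrib_mat_vec[of _ d d] mult_mat_vec[of _ d d])
  then have "(vnorm (C *\<^sub>v (t \<cdot>\<^sub>v u + (1 - t) \<cdot>\<^sub>v v - xopt)))\<^sup>2
      \<le> t * (vnorm (C *\<^sub>v (u - xopt)))\<^sup>2 + (1 - t) * (vnorm (C *\<^sub>v (v - xopt)))\<^sup>2"
    using t by (simp add: vnorm_convex_combination[of _ d])
  then have "ly / (2 * \<mu>\<^sup>2) * ((vnorm (C *\<^sub>v (t \<cdot>\<^sub>v u + (1 - t) \<cdot>\<^sub>v v - xopt)))\<^sup>2
        - (vnorm (C *\<^sub>v xopt))\<^sup>2)
      \<le> ly / (2 * \<mu>\<^sup>2) * (t * (vnorm (C *\<^sub>v (u - xopt)))\<^sup>2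
        + (1 - t) * (vnorm (C *\<^sub>v (v - xopt)))\<^sup>2 - (vnorm (C *\<^sub>v xopt))\<^sup>2)"
    using ly by (intro mult_left_mono) auto
  also have "\<dots> = t * upper_obj d upper lower u + (1 - t) * upper_obj d upper lower v"
    using u v by (simp add: upper_obj_eq algebra_simps add_divide_distrib diff_divide_distrib)
  finally show "upper_obj d upper lower (t \<cdot>\<^sub>v u + (1 - t) \<cdot>\<^sub>v v)
      \<le> t * upper_obj d upper lower u + (1 - t) * upper_obj d upper lower v"
    using u v by (simp add: upper_obj_eq)
qed

text \<open>Holds with equality: the coupling is linear in \<open>y\<close>, and the quadratic part
  obeys the identity for convex combinations.\<close>

lemma strongly_convex_lower:
  assumes x: "x \<in> carrier_vec d"
  shows "strongly_convex_vec d \<mu> (lower x)"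
  unfolding strongly_convex_vec_def
proof (intro ballI)
  fix u v :: "real vec" and t :: real
  assume u: "u \<in> carrier_vec d" and v: "v \<in> carrier_vec d"
  have "lower x (t \<cdot>\<^sub>v u + (1 - t) \<cdot>\<^sub>v v)
      = t * lower x u + (1 - t) * lower x v - \<mu> / 2 * t * (1 - t) * (vnorm (u - v))\<^sup>2"
    using u v
    by (simp add: lower_def scalar_prod_self vnorm_convex_combination[of _ d]
        add_scalar_prod_distrib[of _ d])
      (simp add: algebra_simps add_divide_distrib diff_divide_distrib)
  then show "lower x (t \<cdot>\<^sub>v u + (1 - t) \<cdot>\<^sub>v v)
      \<le> t * lower x u + (1 - t) * lower x v - \<mu> / 2 * t * (1 - t) * (vnorm (u - v))\<^sup>2"
    by simp
qed

lemma xopt_is_arg_min: "is_arg_min (upper_obj d upper lower) (\<lambda>x. x \<in> carrier_vec d) xopt"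
proof -
  have "C *\<^sub>v 0\<^sub>v d = 0\<^sub>v d"
    using C by (intro eq_vecI) auto
  then have "upper_obj d upper lower xopt \<le> upper_obj d upper lower x" if "x \<in> carrier_vec d" for x
    unfolding upper_obj_eq[OF that] upper_obj_eq[OF xopt]
    using xopt ly by (intro mult_left_mono) auto
  then show ?thesis
    unfolding is_arg_min_def using xopt by (auto simp: not_less)
qed

section \<open>Membership in the problem class\<close>

lemma csc_class_upper_lower:
  assumes P: "valid_params P" "mu_y P = \<mu>" "Ly P = ly" "L \<le> Lxy_low P" "\<mu> \<le> Ly_low P"
    "sol_norm P = vnorm xopt"
  shows "csc_class P d d upper lower"
proof -
  have diff_x: "vnorm (\<mu> \<cdot>\<^sub>v y - C *\<^sub>v x - (\<mu> \<cdot>\<^sub>v y - C *\<^sub>v x')) \<le> Lxy_low P * vnorm (x - x')"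
    if "x \<in> carrier_vec d" "x' \<in> carrier_vec d" "y \<in> carrier_vec d" for x x' y
  proof -
    have "\<mu> \<cdot>\<^sub>v y - C *\<^sub>v x - (\<mu> \<cdot>\<^sub>v y - C *\<^sub>v x') = (-1) \<cdot>\<^sub>v (C *\<^sub>v (x - x'))"
      using that C by (intro eq_vecI) (auto simp: mult_minus_distrib_mat_vec[of _ d d])
    then have "vnorm (\<mu> \<cdot>\<^sub>v y - C *\<^sub>v x - (\<mu> \<cdot>\<^sub>v y - C *\<^sub>v x')) = vnorm (C *\<^sub>v (x - x'))"
      by simp
    also have "\<dots> \<le> L * vnorm (x - x')"
      using that by (intro C_le) auto
    also have "\<dots> \<le> Lxy_low P * vnorm (x - x')"
      using P by (intro mult_right_mono) auto
    finally show ?thesis .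
  qed
  \<comment> \<open>Covers both levels: \<open>c\<close> is \<open>ly\<close> for the upper gradient
    and \<open>\<mu>\<close> for the lower one, and \<open>a\<close> is the part that stays fixed as
    \<open>y\<close> varies.\<close>
  have diff_y: "vnorm (c \<cdot>\<^sub>v y - a - (c \<cdot>\<^sub>v y' - a)) = \<bar>c\<bar> * vnorm (y - y')"
    if "a \<in> carrier_vec d" "y \<in> carrier_vec d" "y' \<in> carrier_vec d" for a y y' c
  proof -
    have "c \<cdot>\<^sub>v y - a - (c \<cdot>\<^sub>v y' - a) = c \<cdot>\<^sub>v (y - y')"
      using that by (intro eq_vecI) (auto simp: algebra_simps)
    then show ?thesis
      by simp
  qed
  have [simp]: "A - A = 0\<^sub>m d d" if "A \<in> carrier_mat d d" for A :: "real mat"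
    using that by auto
  have jac: "has_jacobian d d (\<lambda>x'. grad_y d lower x' y) (- C) x"
    "has_jacobian d d (grad_y d lower x) (\<mu> \<cdot>\<^sub>m 1\<^sub>m d) y"
    if "x \<in> carrier_vec d" "y \<in> carrier_vec d" for x y
    using that C
    by (auto intro!: has_jacobian_affine
        simp: grad_y_lower_affine_x grad_y_lower_affine_y grad_y_lower_carrier)
  show ?thesis
    unfolding csc_class_def lipschitz_x_def lipschitz_y_def lipschitz_mat_def
  proof (intro conjI ballI)
    show "\<exists>v. has_gradient d (\<lambda>x'. upper x' y) v x" "\<exists>v. has_gradient d (upper x) v y"
      "\<exists>v. has_gradient d (lower x) v y"
      if "x \<in> carrier_vec d" "y \<in> carrier_vec d" for x y
      using that by (blast intro: has_grad_x_upper has_grad_y_upper has_grad_y_lower)+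
  next
    show "\<exists>xopt. is_arg_min (upper_obj d upper lower) (\<lambda>x. x \<in> carrier_vec d) xopt
        \<and> vnorm xopt = sol_norm P"
      using xopt_is_arg_min P by auto
  next
    show "vnorm (grad_x d upper x y - grad_x d upper x' y) \<le> Lx P * vnorm (x - x')"
      "vnorm (grad_x d upper x y - grad_x d upper x y') \<le> Lxy P * vnorm (y - y')" for x x' y y'
      using P by (simp_all add: grad_x_upper valid_params_def)
  next
    show "vnorm (grad_y d upper x y - grad_y d upper x' y) \<le> Lxy P * vnorm (x - x')"
      if "y \<in> carrier_vec d" for x x' y
    proof -
      have "grad_y d upper x y - grad_y d upper x' y = 0\<^sub>v d"
        using that by (simp add: grad_y_upper minus_cancel_vec[of _ d])
      then show ?thesis
        using P by (simp add: valid_params_def)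
    qed
  next
    show "vnorm (grad_y d upper x y - grad_y d upper x y') \<le> Ly P * vnorm (y - y')"
      if "y \<in> carrier_vec d" "y' \<in> carrier_vec d" for x y y'
      using that P ly by (simp add: grad_y_upper diff_y)
  next
    show "vnorm (grad_y d lower x y - grad_y d lower x' y) \<le> Lxy_low P * vnorm (x - x')"
      if "x \<in> carrier_vec d" "x' \<in> carrier_vec d" "y \<in> carrier_vec d" for x x' y
      using that diff_x by (simp add: grad_y_lower)
  next
    show "vnorm (grad_y d lower x y - grad_y d lower x y') \<le> Ly_low P * vnorm (y - y')"
      if "y \<in> carrier_vec d" "y' \<in> carrier_vec d" for x y y'
      using that P \<mu> by (simp add: grad_y_lower diff_y mult_right_mono)
  next
    show "opnorm (grad_xy d d lower x y - grad_xy d d lower x' y')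
        \<le> rho_xy P * sqrt ((vnorm (x - x'))\<^sup>2 + (vnorm (y - y'))\<^sup>2)"
      if "x \<in> carrier_vec d" "x' \<in> carrier_vec d" "y \<in> carrier_vec d" "y' \<in> carrier_vec d"
      for x x' y y'
      using that P C by (simp add: grad_xy_lower opnorm_zero valid_params_def)
  next
    show "opnorm (hess_y d lower x y - hess_y d lower x' y')
        \<le> rho_yy P * sqrt ((vnorm (x - x'))\<^sup>2 + (vnorm (y - y'))\<^sup>2)"
      if "y \<in> carrier_vec d" "y' \<in> carrier_vec d" for x x' y y'
      using that P by (simp add: hess_y_lower opnorm_zero valid_params_def)
  qed (use P jac convex_upper_obj strongly_convex_lower in blast)+
qed

section \<open>The coordinates an algorithm can reach\<close>

lemma foldr_hess_y_lower:
  assumes "set zs \<subseteq> carrier_vec d \<times> carrier_vec d"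
  shows "\<exists>c. foldr (*) (map (\<lambda>(u, w). 1\<^sub>m d - \<alpha> \<cdot>\<^sub>m hess_y d lower u w) zs) (1\<^sub>m d) = c \<cdot>\<^sub>m 1\<^sub>m d"
  using assms
proof (induction zs)
  case Nil
  have "1\<^sub>m d = 1 \<cdot>\<^sub>m (1\<^sub>m d :: real mat)"
    by auto
  then show ?case
    by auto
next
  case (Cons z zs)
  then obtain c where c: "foldr (*) (map (\<lambda>(u, w). 1\<^sub>m d - \<alpha> \<cdot>\<^sub>m hess_y d lower u w) zs) (1\<^sub>m d)
      = c \<cdot>\<^sub>m 1\<^sub>m d"
    by auto
  \<comment> \<open>Each factor is a multiple of the identity because the Hessian is, and products
    of such factors remain multiples of it.\<close>
  have *: "1\<^sub>m d - \<alpha> \<cdot>\<^sub>m (\<mu> \<cdot>\<^sub>m 1\<^sub>m d) = (1 - \<alpha> * \<mu>) \<cdot>\<^sub>m (1\<^sub>m d :: real mat)"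
    by (intro eq_matI) auto
  have "((1 - \<alpha> * \<mu>) \<cdot>\<^sub>m 1\<^sub>m d) * (c \<cdot>\<^sub>m 1\<^sub>m d) = ((1 - \<alpha> * \<mu>) * c) \<cdot>\<^sub>m (1\<^sub>m d :: real mat)"
    by (intro eq_matI) auto
  then show ?case
    using Cons.prems by (cases z) (auto simp: hess_y_lower c *)
qed

text \<open>The lower gradient is the only generator that multiplies by \<open>C\<close>, so an
  iteration opens at most one new coordinate; the hypergradient applies the transpose, which opens
  none.\<close>

lemma Hx_Hy_subset_zero_from:
  assumes C_step: "\<And>v n. v \<in> zero_from d n \<Longrightarrow> C *\<^sub>v v \<in> zero_from d (Suc n)"
    and Ct_step: "\<And>v n. v \<in> zero_from d n \<Longrightarrow> transpose_mat (- C) *\<^sub>v v \<in> zero_from d n"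
    and C_xopt: "C *\<^sub>v xopt \<in> zero_from d 1"
  shows "Hx d d upper lower T S n \<subseteq> zero_from d n \<and> Hy d d upper lower T S n \<subseteq> zero_from d n"
proof (induction n rule: less_induct)
  case (less n)
  show ?case
  proof (cases n)
    case 0
    then show ?thesis
      by simp
  next
    case (Suc m)
    let ?X = "Hx d d upper lower T S" and ?Y = "Hy d d upper lower T S"
    \<comment> \<open>Level \<open>n = Suc m\<close> draws on every level up to \<open>m\<close>,
      hence the strong induction; all of them are viewed inside the common space
      \<open>zero_from d m\<close>.\<close>
    have XY: "?X i \<subseteq> zero_from d m" "?Y i \<subseteq> zero_from d m" if "i \<le> m" for i
      using less.IH[of i] zero_from_mono[OF that, of d] that Suc by auto
    have mono: "zero_from d m \<subseteq> zero_from d n"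
      using Suc by (intro zero_from_mono) simp
    \<comment> \<open>The constant term \<open>C *\<^sub>v xopt\<close> may occupy coordinate 0, so
      \<open>1 \<le> m\<close> matters. It is available because generators are collected from levels
      \<open>i \<ge> 1\<close>.\<close>
    have grad: "grad_y d upper x y \<in> zero_from d m" if "y \<in> zero_from d m" "1 \<le> m" for x y
      using that C_xopt zero_from_mono[of 1 m d] zero_from_carrier[OF that(1)]
      by (auto simp: grad_y_upper intro!: minus_in_zero_from smult_in_zero_from)
    have x: "x_gens d d upper lower T (?X i) (?Y i) \<subseteq> zero_from d m" if i: "i \<in> {1..m}" for i
    proof -
      have "grad_xy d d lower x y *\<^sub>v
          (foldr (*) (map (\<lambda>(u, w). 1\<^sub>m d - \<alpha> \<cdot>\<^sub>m hess_y d lower u w) zs) (1\<^sub>m d) *\<^sub>v grad_y d upper x' y')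
          \<in> zero_from d m"
        if "x \<in> ?X i" "y \<in> ?Y i" "x' \<in> ?X i" "y' \<in> ?Y i" "set zs \<subseteq> ?X i \<times> ?Y i" for x y x' y' zs \<alpha>
      proof -
        have in_XY: "x \<in> zero_from d m" "y \<in> zero_from d m" "y' \<in> zero_from d m"
          "set zs \<subseteq> carrier_vec d \<times> carrier_vec d"
          using that XY[of i] i by (auto dest!: zero_from_carrier)
        obtain c where c: "foldr (*) (map (\<lambda>(u, w). 1\<^sub>m d - \<alpha> \<cdot>\<^sub>m hess_y d lower u w) zs) (1\<^sub>m d)
            = c \<cdot>\<^sub>m 1\<^sub>m d"
          using foldr_hess_y_lower[OF in_XY(4)] by blast
        have g: "grad_y d upper x' y' \<in> zero_from d m"
          using grad in_XY i by auto
        have "(c \<cdot>\<^sub>m 1\<^sub>m d) *\<^sub>v grad_y d upper x' y' = c \<cdot>\<^sub>v grad_y d upper x' y'"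
          using zero_from_carrier[OF g] by (intro eq_vecI) auto
        then show ?thesis
          unfolding c using in_XY g
          by (auto simp: grad_xy_lower zero_from_carrier intro!: Ct_step smult_in_zero_from)
      qed
      then show ?thesis
        using XY[of i] i unfolding x_gens_def by (auto simp: grad_x_upper)
    qed
    \<comment> \<open>Here the bound is \<open>n\<close> and not \<open>m\<close>: the term
      \<open>C *\<^sub>v x\<close> costs one coordinate.\<close>
    have y: "y_gens d lower (?X i) (?Y i) \<subseteq> zero_from d n" if i: "i \<in> {1..m}" for i
    proof -
      have "grad_y d lower x y \<in> zero_from d n" if "x \<in> ?X i" "y \<in> ?Y i" for x y
      proof -
        have *: "x \<in> zero_from d m" "y \<in> zero_from d m"
          using that XY[of i] i by auto
        then show ?thesis
          using mono C_step[of x m] Suc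
          by (auto simp: grad_y_lower zero_from_carrier intro!: minus_in_zero_from smult_in_zero_from)
      qed
      then show ?thesis
        using XY[of i] i mono unfolding y_gens_def by auto
    qed
    have "vspan d (\<Union>i\<in>{1..m}. y_gens d lower (?X i) (?Y i)) \<subseteq> zero_from d n"
      using y by (intro vspan_subset_zero_from) blast
    then have "?Y n \<subseteq> zero_from d n"
      using Suc by simp
    moreover have "?X n \<subseteq> zero_from d n"
    proof (cases "n \<in> S")
      case True
      have "vspan d (\<Union>i\<in>{1..m}. x_gens d d upper lower T (?X i) (?Y i)) \<subseteq> zero_from d m"
        using x by (intro vspan_subset_zero_from) blast
      then show ?thesis
        using True mono Suc by simp
    next
      case False
      then show ?thesis
        using XY(1)[of m] mono Suc by simp
    qed
    ultimately show ?thesis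
      by blast
  qed
qed

end

section \<open>The backward difference matrix\<close>

definition diff_mat :: "nat \<Rightarrow> real mat" where
  "diff_mat d = mat d d (\<lambda>(i, j). if i = j then 1 else if i = Suc j then - 1 else 0)"

lemma diff_mat_carrier: "diff_mat d \<in> carrier_mat d d"
  by (simp add: diff_mat_def)

text \<open>Row \<open>i\<close> splits into its diagonal and its subdiagonal entry; row 0 lacks the
  latter, which amounts to a boundary value 0 in front of \<open>v\<close>.\<close>

lemma diff_mat_mult_index:
  assumes v: "v \<in> carrier_vec d" and i: "i < d"
  shows "(diff_mat d *\<^sub>v v) $ i = v $ i - (case i of 0 \<Rightarrow> 0 | Suc j \<Rightarrow> v $ j)"
proof -
  have "(diff_mat d *\<^sub>v v) $ i = (\<Sum>j\<in>{0..<d}. (if i = j then 1 else if i = Suc j then - 1 else 0) * v $ j)"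
    using v i by (simp add: diff_mat_def scalar_prod_def)
  also have "\<dots> = (\<Sum>j\<in>{0..<d}. (if j = i then v $ j else 0) - (if i = Suc j then v $ j else 0))"
    by (intro sum.cong) auto
  also have "\<dots> = v $ i - (case i of 0 \<Rightarrow> 0 | Suc j \<Rightarrow> v $ j)"
    using i by (cases i) (auto simp: sum_subtractf)
  finally show ?thesis .
qed

lemma transpose_diff_mat_mult_index:
  assumes v: "v \<in> carrier_vec d" and i: "i < d"
  shows "(transpose_mat (diff_mat d) *\<^sub>v v) $ i = v $ i - (if Suc i < d then v $ Suc i else 0)"
proof -
  have "(transpose_mat (diff_mat d) *\<^sub>v v) $ i
      = (\<Sum>j\<in>{0..<d}. (if j = i then 1 else if j = Suc i then - 1 else 0) * v $ j)"
    using v i by (simp add: diff_mat_def scalar_prod_def)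
  also have "\<dots> = (\<Sum>j\<in>{0..<d}. (if j = i then v $ j else 0) - (if j = Suc i then v $ j else 0))"
    by (intro sum.cong) auto
  also have "\<dots> = v $ i - (if Suc i < d then v $ Suc i else 0)"
    using i by (simp add: sum_subtractf)
  finally show ?thesis .
qed

lemma vnorm_diff_mat_mult_le:
  assumes v: "v \<in> carrier_vec d"
  shows "vnorm (diff_mat d *\<^sub>v v) \<le> 2 * vnorm v"
proof -
  \<comment> \<open>The shift of \<open>v\<close>: it puts 0 in front and drops the last coordinate,
    so its norm is at most that of \<open>v\<close>.\<close>
  define p where "p i = (case i of 0 \<Rightarrow> 0 | Suc j \<Rightarrow> v $ j)" for i
  have norm_v: "(vnorm v)\<^sup>2 = (\<Sum>i<d. (v $ i)\<^sup>2)"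
    using v by (simp add: vnorm_square)
  have "(\<Sum>i<d. (p i)\<^sup>2) \<le> (\<Sum>i<d. (v $ i)\<^sup>2)"
  proof (cases d)
    case (Suc n)
    then have "(\<Sum>i<d. (p i)\<^sup>2) = (\<Sum>i<n. (v $ i)\<^sup>2)"
      by (simp add: p_def sum.lessThan_Suc_shift del: sum.lessThan_Suc)
    then show ?thesis
      using Suc by simp
  qed simp
  moreover have "(vnorm (diff_mat d *\<^sub>v v))\<^sup>2 = (\<Sum>i<d. (v $ i - p i)\<^sup>2)"
    using v diff_mat_carrier[of d]
    by (simp add: vnorm_square diff_mat_mult_index p_def del: index_mult_mat_vec)
  moreover have "(v $ i - p i)\<^sup>2 \<le> 2 * (v $ i)\<^sup>2 + 2 * (p i)\<^sup>2" for i
    using zero_le_power2[of "v $ i + p i"] by (simp add: power2_eq_square algebra_simps)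
  then have "(\<Sum>i<d. (v $ i - p i)\<^sup>2) \<le> (\<Sum>i<d. 2 * (v $ i)\<^sup>2 + 2 * (p i)\<^sup>2)"
    by (intro sum_mono)
  ultimately have "(vnorm (diff_mat d *\<^sub>v v))\<^sup>2 \<le> (2 * vnorm v)\<^sup>2"
    by (simp add: norm_v sum.distrib sum_distrib_left[symmetric] power_mult_distrib)
  then show ?thesis
    by (rule power2_le_imp_le) simp
qed

lemma sum_diff_mat_mult:
  assumes v: "v \<in> carrier_vec (Suc m)"
  shows "(\<Sum>i<Suc m. (diff_mat (Suc m) *\<^sub>v v) $ i) = v $ m"
proof -
  \<comment> \<open>Partial sums of every length for a fixed \<open>v\<close>, so that the induction
    leaves the dimension alone.\<close>
  have "(\<Sum>i<Suc n. v $ i - (case i of 0 \<Rightarrow> 0 | Suc j \<Rightarrow> v $ j)) = v $ n" for n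
    by (induction n) auto
  then show ?thesis
    using v by (simp add: diff_mat_mult_index del: sum.lessThan_Suc index_mult_mat_vec)
qed

text \<open>Row \<open>i\<close> reads coordinates \<open>i - 1\<close> and \<open>i\<close>, so
  nonzero entries move at most one place to the right.\<close>

lemma diff_mat_mult_in_zero_from:
  assumes "v \<in> zero_from d n"
  shows "diff_mat d *\<^sub>v v \<in> zero_from d (Suc n)"
  using assms diff_mat_carrier[of d]
  by (auto simp: zero_from_def diff_mat_mult_index split: nat.split simp del: index_mult_mat_vec)

text \<open>Row \<open>i\<close> reads coordinates \<open>i\<close> and \<open>Suc i\<close>; past
  the support both are zero.\<close>

lemma transpose_diff_mat_mult_in_zero_from:
  assumes "v \<in> zero_from d n"
  shows "transpose_mat (diff_mat d) *\<^sub>v v \<in> zero_from d n"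
  using assms diff_mat_carrier[of d]
  by (auto simp: zero_from_def transpose_diff_mat_mult_index simp del: index_mult_mat_vec)

section \<open>The hard instance in a given dimension\<close>

lemma csc_hard_instance:
  assumes P: "valid_params P" "0 < Ly P" "Lxy_low P = 2 * a" "mu_y P \<le> Ly_low P"
    and d: "0 < d"
  shows "\<exists>f g. csc_class P d d f g \<and> (\<forall>K Q T s xs ys. hypergradient_run d d f g K Q T s xs ys \<longrightarrow>
    K < d \<longrightarrow> Ly P * a\<^sup>2 * sol_norm P / ((mu_y P)\<^sup>2 * (real d)\<^sup>2)
      \<le> vnorm (grad d (upper_obj d f g) (xs K)))"
proof -
  have pos: "0 < mu_y P" "0 < sol_norm P" "0 \<le> a"
    using P by (auto simp: valid_params_def)
  obtain m where m: "d = Suc m"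
    using d by (cases d) auto
  \<comment> \<open>Spreads the norm \<open>sol_norm P\<close> equally over the \<open>d\<close>
    coordinates of \<open>xopt\<close>.\<close>
  define \<gamma> where "\<gamma> = sol_norm P / sqrt d"
  \<comment> \<open>\<open>diff_mat\<close> at most doubles norms, so \<open>C\<close> respects the
    Lipschitz constant \<open>2 * a\<close>.\<close>
  define C where "C = a \<cdot>\<^sub>m diff_mat d"
  define xopt where "xopt = vec d (\<lambda>_. \<gamma>)"
  define w where "w = vec d (\<lambda>i. real (Suc i))"
  have \<gamma>: "\<gamma> > 0"
    using pos d by (simp add: \<gamma>_def)
  have xopt: "xopt \<in> carrier_vec d" and w: "w \<in> carrier_vec d"
    by (auto simp: xopt_def w_def)
  have C_mult: "C *\<^sub>v v = a \<cdot>\<^sub>v (diff_mat d *\<^sub>v v)"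
    and Ct_mult: "transpose_mat (- C) *\<^sub>v v = (- a) \<cdot>\<^sub>v (transpose_mat (diff_mat d) *\<^sub>v v)"
    if "v \<in> carrier_vec d" for v
  proof -
    show "C *\<^sub>v v = a \<cdot>\<^sub>v (diff_mat d *\<^sub>v v)"
      using that diff_mat_carrier[of d] by (intro eq_vecI) (auto simp: C_def)
    have "transpose_mat (- C) = (- a) \<cdot>\<^sub>m transpose_mat (diff_mat d)"
      by (intro eq_matI) (auto simp: C_def)
    then show "transpose_mat (- C) *\<^sub>v v = (- a) \<cdot>\<^sub>v (transpose_mat (diff_mat d) *\<^sub>v v)"
      using that diff_mat_carrier[of d] by (intro eq_vecI) auto
  qed
  interpret quadratic_bilevel d C "mu_y P" "Ly P" "2 * a" xopt
  proof
    show "C \<in> carrier_mat d d"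
      using diff_mat_carrier[of d] by (simp add: C_def)
    show "vnorm (C *\<^sub>v v) \<le> 2 * a * vnorm v" if "v \<in> carrier_vec d" for v
      using mult_left_mono[OF vnorm_diff_mat_mult_le[OF that] pos(3)] pos that
      by (simp add: C_mult)
  qed (use P pos xopt in auto)
  have "(vnorm xopt)\<^sup>2 = (sol_norm P)\<^sup>2"
    using d by (simp add: vnorm_square xopt_def \<gamma>_def power_divide)
  then have norm_xopt: "vnorm xopt = sol_norm P"
    using pos by (simp add: power2_eq_iff_nonneg)
  have "(vnorm w)\<^sup>2 = (\<Sum>i<d. (real (Suc i))\<^sup>2)"
    by (simp add: vnorm_square w_def)
  also have "\<dots> \<le> (\<Sum>i<d. (real d)\<^sup>2)"
    by (intro sum_mono power_mono) auto
  also have "\<dots> = (real d * sqrt d)\<^sup>2"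
    by (simp add: power_mult_distrib)
  finally have norm_w: "vnorm w \<le> real d * sqrt d"
    by (rule power2_le_imp_le) simp
  \<comment> \<open>Row 0 is included: \<open>w\<close> starts at 1 and the boundary value is
    0.\<close>
  have w_index: "(diff_mat d *\<^sub>v w) $ i = 1" if "i < d" for i
    using that w by (cases i) (auto simp: diff_mat_mult_index w_def simp del: index_mult_mat_vec)
  have xopt_index: "(diff_mat d *\<^sub>v xopt) $ i = 0" if "1 \<le> i" "i < d" for i
    using that xopt by (cases i) (auto simp: diff_mat_mult_index xopt_def simp del: index_mult_mat_vec)
  have C_step: "C *\<^sub>v v \<in> zero_from d (Suc n)"
    and Ct_step: "transpose_mat (- C) *\<^sub>v v \<in> zero_from d n" if "v \<in> zero_from d n" for v n
    using that zero_from_carrier[OF that]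
    by (simp_all only: C_mult Ct_mult diff_mat_mult_in_zero_from
        transpose_diff_mat_mult_in_zero_from smult_in_zero_from)
  have C_xopt: "C *\<^sub>v xopt \<in> zero_from d 1"
    using xopt xopt_index diff_mat_carrier[of d]
    by (auto simp: C_mult zero_from_def simp del: index_mult_mat_vec)
  have grad_ge: "Ly P * a\<^sup>2 * sol_norm P / ((mu_y P)\<^sup>2 * (real d)\<^sup>2)
      \<le> vnorm (grad d (upper_obj d upper lower) x)" if x: "x \<in> zero_from d K" "K < d" for x K
  proof -
    have x': "x \<in> carrier_vec d"
      using x zero_from_carrier by blast
    have z: "x - xopt \<in> carrier_vec d"
      using x' xopt by auto
    have "(C *\<^sub>v w) \<bullet> (C *\<^sub>v (x - xopt)) = a\<^sup>2 * (\<Sum>i<d. (diff_mat d *\<^sub>v (x - xopt)) $ i)"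
      using w z diff_mat_carrier[of d]
      by (simp add: C_mult scalar_prod_def w_index lessThan_atLeast0 power2_eq_square
          sum_distrib_left[symmetric] mult.assoc del: index_mult_mat_vec)
    also have "\<dots> = a\<^sup>2 * (x - xopt) $ m"
      using sum_diff_mat_mult[of "x - xopt" m] z m by simp
    \<comment> \<open>\<open>m\<close> is the last index and \<open>K < Suc m\<close>, so coordinate
      \<open>m\<close> of \<open>x\<close> is still zero.\<close>
    also have "\<dots> = - (a\<^sup>2 * \<gamma>)"
      using x m by (simp add: xopt_def zero_from_def)
    finally have "Ly P / (mu_y P)\<^sup>2 * (a\<^sup>2 * \<gamma>)
        \<le> vnorm (grad d (upper_obj d upper lower) x) * vnorm w"
      using vnorm_grad_upper_obj_ge[OF x' w] \<gamma> by (simp add: abs_mult)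
    also have "\<dots> \<le> vnorm (grad d (upper_obj d upper lower) x) * (real d * sqrt d)"
      using norm_w by (intro mult_left_mono) auto
    finally have le: "Ly P / (mu_y P)\<^sup>2 * (a\<^sup>2 * \<gamma>)
        \<le> vnorm (grad d (upper_obj d upper lower) x) * (real d * sqrt d)" .
    \<comment> \<open>In terms of \<open>r\<close>, \<open>\<gamma>\<close> is
      \<open>sol_norm P / r\<close> and the bound on \<open>vnorm w\<close> is the cube of
      \<open>r\<close>; their quotient yields the factor
      \<open>1 / (real d)\<^sup>2\<close>.\<close>
    define r where "r = sqrt d"
    have r: "real d = r * r" "0 < r"
      using d by (simp_all add: r_def)
    have "Ly P / (mu_y P)\<^sup>2 * (a\<^sup>2 * (sol_norm P / r))
        \<le> vnorm (grad d (upper_obj d upper lower) x) * (r * r * r)"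
      using le unfolding \<gamma>_def r_def[symmetric] unfolding r(1) .
    then show ?thesis
      unfolding r(1) using r(2) pos by (simp add: field_simps power2_eq_square)
  qed
  show ?thesis
  proof (intro exI conjI allI impI)
    show "csc_class P d d upper lower"
      using P norm_xopt by (intro csc_class_upper_lower) auto
    fix K Q T s xs ys
    assume run: "hypergradient_run d d upper lower K Q T s xs ys" and K: "K < d"
    have "xs K \<in> Hx d d upper lower T (s ` {..<Q}) K"
      using run by (simp add: hypergradient_run_def)
    then have "xs K \<in> zero_from d K"
      using Hx_Hy_subset_zero_from[OF C_step Ct_step C_xopt] by blast
    then show "Ly P * a\<^sup>2 * sol_norm P / ((mu_y P)\<^sup>2 * (real d)\<^sup>2)
        \<le> vnorm (grad d (upper_obj d upper lower) (xs K))"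
      using K by (rule grad_ge)
  qed
qed

section \<open>Choice of the dimension and the resulting complexity bound\<close>

theorem corollary4:
  fixes \<tau> B lx ly lxy_low beta_max :: real
  assumes "0 < \<tau>" and "0 < B" and "0 \<le> lx" and "0 < ly" and "0 < lxy_low" and "0 \<le> beta_max"
  shows "\<exists>c>0. \<exists>k::nat. \<exists>\<epsilon>\<^sub>0>0. \<exists>\<mu>\<^sub>0>0. \<forall>\<epsilon> P.
    0 < \<epsilon> \<and> \<epsilon> < \<epsilon>\<^sub>0 \<and> valid_params P \<and> mu_y P < \<mu>\<^sub>0 \<and>
    Lx P = lx \<and> Ly P = ly \<and> Lxy_low P = lxy_low \<and> sol_norm P = B \<and>
    0 \<le> beta P \<and> beta P \<le> beta_max \<longrightarrow>
    (\<exists>d f g. csc_class P d d f g \<and>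
      (\<forall>K Q T s xs ys.
        hypergradient_run d d f g K Q T s xs ys \<and>
        vnorm (grad d (upper_obj d f g) (xs K)) \<le> \<epsilon> \<longrightarrow>
        (let R = 1 / sqrt \<epsilon> * min (1 / mu_y P) (1 / sqrt (\<epsilon> ^ 3))
         in C_norm \<tau> K Q T \<ge> c * R / ln R ^ k)))"
proof -
  \<comment> \<open>Chosen so that the gradient bound of the hard instance is the square of
    \<open>M / (mu_y P * real d)\<close>.\<close>
  define M where "M = sqrt (ly * (lxy_low / 2)\<^sup>2 * B)"
  have M: "M > 0" "M\<^sup>2 = ly * (lxy_low / 2)\<^sup>2 * B"
    using assms by (auto simp: M_def)
  have main: "\<exists>d f g. csc_class P d d f g \<and>
      (\<forall>K Q T s xs ys.
        hypergradient_run d d f g K Q T s xs ys \<and>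
        vnorm (grad d (upper_obj d f g) (xs K)) \<le> \<epsilon> \<longrightarrow>
        (let R = 1 / sqrt \<epsilon> * min (1 / mu_y P) (1 / sqrt (\<epsilon> ^ 3))
         in C_norm \<tau> K Q T \<ge> M / 4 * R / ln R ^ 0))"
    if asm: "0 < \<epsilon> \<and> \<epsilon> < 1 \<and> valid_params P \<and> mu_y P < M / 4 \<and>
      Lx P = lx \<and> Ly P = ly \<and> Lxy_low P = lxy_low \<and> sol_norm P = B \<and>
      0 \<le> beta P \<and> beta P \<le> beta_max" for \<epsilon> P
  proof -
    from asm have \<mu>: "0 < mu_y P" "mu_y P \<le> Ly_low P" and \<epsilon>: "0 < sqrt \<epsilon>" "sqrt \<epsilon> < 1"
      by (auto simp: valid_params_def beta_def)
    \<comment> \<open>\<open>X\<close> is the dimension at which the gradient bound equals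
      \<open>\<epsilon>\<close>. Half of it leaves a strict gap for the contradiction below.\<close>
    define X where "X = M / (mu_y P * sqrt \<epsilon>)"
    define d where "d = nat \<lfloor>X / 2\<rfloor>"
    have "mu_y P * sqrt \<epsilon> \<le> mu_y P"
      using \<mu> \<epsilon> by (intro mult_left_le) auto
    then have "4 * (mu_y P * sqrt \<epsilon>) \<le> M"
      using asm by linarith
    \<comment> \<open>The thresholds \<open>1\<close> for \<open>\<epsilon>\<close> and
      \<open>M / 4\<close> for \<open>mu_y P\<close> are made for this bound; from
      \<open>4 \<le> X\<close>, rounding \<open>X / 2\<close> down still leaves at least
      \<open>X / 4\<close>.\<close>
    then have X: "4 \<le> X"
      using asm \<mu> \<epsilon> by (simp add: X_def pos_le_divide_eq)
    then have d: "X / 4 \<le> real d" "real d \<le> X / 2" "0 < d"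
      unfolding d_def by linarith+
    have pre: "valid_params P" "0 < Ly P" "Lxy_low P = 2 * (lxy_low / 2)"
      using asm assms by auto
    obtain f g where fg: "csc_class P d d f g"
      and hard: "\<And>K Q T s xs ys. hypergradient_run d d f g K Q T s xs ys \<Longrightarrow> K < d \<Longrightarrow>
        Ly P * (lxy_low / 2)\<^sup>2 * sol_norm P / ((mu_y P)\<^sup>2 * (real d)\<^sup>2)
        \<le> vnorm (grad d (upper_obj d f g) (xs K))"
      using csc_hard_instance[OF pre \<mu>(2) d(3)] by blast
    have K_ge: "X / 4 \<le> real K" if run: "hypergradient_run d d f g K Q T s xs ys"
      and small: "vnorm (grad d (upper_obj d f g) (xs K)) \<le> \<epsilon>" for K Q T s xs ys
    proof (rule ccontr)
      assume "\<not> X / 4 \<le> real K"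
      then have "K < d"
        using d by simp
      \<comment> \<open>If \<open>K < d\<close>, the accuracy \<open>\<epsilon>\<close> would force
        \<open>X \<le> real d\<close>, against \<open>real d \<le> X / 2\<close>.\<close>
      then have "M\<^sup>2 / ((mu_y P)\<^sup>2 * (real d)\<^sup>2) \<le> \<epsilon>"
        using hard[OF run] small asm M(2) by simp
      then have "X\<^sup>2 \<le> (real d)\<^sup>2"
        using \<mu> \<epsilon> d asm by (simp add: X_def power_divide power_mult_distrib field_simps)
      then have "X \<le> real d"
        by (rule power2_le_imp_le) simp
      then show False
        using d X by simp
    qed
    have C_norm_ge: "real K \<le> C_norm \<tau> K Q T" for K Q T
      using assms by (simp add: C_norm_def)
    \<comment> \<open>The minimum is bounded by its first argument, so the bound proved for
      \<open>K\<close> is at least the stated rate.\<close>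
    have R_le: "M / 4 * (1 / sqrt \<epsilon> * min (1 / mu_y P) (1 / sqrt (\<epsilon> ^ 3))) \<le> X / 4"
    proof -
      have "M / 4 * (1 / sqrt \<epsilon> * min (1 / mu_y P) (1 / sqrt (\<epsilon> ^ 3)))
          \<le> M / 4 * (1 / sqrt \<epsilon> * (1 / mu_y P))"
        using M \<epsilon> by (intro mult_left_mono) auto
      also have "\<dots> = X / 4"
        by (simp add: X_def)
      finally show ?thesis .
    qed
    show ?thesis
    proof (rule exI[of _ d], rule exI[of _ f], rule exI[of _ g], intro conjI fg allI impI)
      fix K Q T s xs ys
      assume "hypergradient_run d d f g K Q T s xs ys \<and>
        vnorm (grad d (upper_obj d f g) (xs K)) \<le> \<epsilon>"
      then have "X / 4 \<le> real K"
        using K_ge by blast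
      then have "M / 4 * (1 / sqrt \<epsilon> * min (1 / mu_y P) (1 / sqrt (\<epsilon> ^ 3))) \<le> C_norm \<tau> K Q T"
        using R_le C_norm_ge[of K Q T] by linarith
      then show "let R = 1 / sqrt \<epsilon> * min (1 / mu_y P) (1 / sqrt (\<epsilon> ^ 3))
        in C_norm \<tau> K Q T \<ge> M / 4 * R / ln R ^ 0"
        by (simp only: Let_def power_0 div_by_1)
    qed
  qed
  show ?thesis
    \<comment> \<open>The witnesses are \<open>c = M / 4\<close>, \<open>k = 0\<close>,
      \<open>\<epsilon>\<^sub>0 = 1\<close> and \<open>\<mu>\<^sub>0 = M / 4\<close>; with
      \<open>k = 0\<close> no logarithmic factor is lost.\<close>
    by (rule exI[of _ "M / 4"], rule conjI, use M in simp, rule exI[of _ 0], rule exI[of _ 1],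
        rule conjI, simp, rule exI[of _ "M / 4"], rule conjI, use M in simp, intro allI impI,
        rule main)
qed

end
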